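(* Suppose $\gamma:\mathbb{S}\to\mathbb{R}^2$ is a smooth closed immersed ideal curve, that is, $$k_{s^4}+k_{ss}k^2-\tfrac12k_s^2k=0$$ along $\gamma$. Then $\gamma(\mathbb{S})=\mathbb{S}_r(x)$ for some $r>0$ and $x\in\mathbb{R}^2$, that is, $\gamma$ is a standard round $\omega$-circle.
   Context: $\mathbb{S}$ is the circle. For a smooth closed immersed curve $\gamma:\mathbb{S}\to\mathbb{R}^2$: $s$ is Euclidean arc-length, subscripts $s$ denote arc-length derivatives ($k_{s^4}=k_{ssss}$), $\tau=\gamma_s=(\tau_1,\tau_2)$ is the unit tangent, $\nu=(-\tau_2,\tau_1)$ the unit normal, $k=\langle\gamma_{ss},\nu\rangle$ the curvature, and $\omega=\frac1{2\pi}\int_\gamma k\,ds$ the winding number. $\mathbb{S}_r(x)$ is the round circle of radius $r$ centred at $x$. A standard round $\omega$-circle is a round circle covered $|\omega|$ times with winding number $\omega$. *)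

theory Defs
  imports "HOL-Analysis.Analysis"
begin

text \<open>
  The domain of a closed curve is the unit circle of the complex plane. Derivatives are taken in
  the angle coordinate; quantities along the curve (speed, tangent, curvature, ...) are
  \<open>2 * pi\<close>-periodic functions of the angle.
\<close>

abbreviation unit_circle :: "complex set"
  where "unit_circle \<equiv> sphere 0 1"

definition lift :: "(complex \<Rightarrow> real ^ 2) \<Rightarrow> real \<Rightarrow> real ^ 2"
  where "lift \<gamma> t = \<gamma> (cis t)"

definition vderiv :: "(real \<Rightarrow> 'a::real_normed_vector) \<Rightarrow> real \<Rightarrow> 'a"
  where "vderiv f t = vector_derivative f (at t)"

definition smooth :: "(real \<Rightarrow> 'a::real_normed_vector) \<Rightarrow> bool"
  where "smooth f \<longleftrightarrow> (\<forall>n t. (vderiv ^^ n) f differentiable (at t))"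

definition smooth_closed_immersed :: "(complex \<Rightarrow> real ^ 2) \<Rightarrow> bool"
  where "smooth_closed_immersed \<gamma> \<longleftrightarrow> smooth (lift \<gamma>) \<and> (\<forall>t. vderiv (lift \<gamma>) t \<noteq> 0)"

definition speed :: "(complex \<Rightarrow> real ^ 2) \<Rightarrow> real \<Rightarrow> real"
  where "speed \<gamma> t = norm (vderiv (lift \<gamma>) t)"

text \<open>
  The arc-length derivative \<open>f\<^sub>s\<close> along \<open>\<gamma>\<close>, from \<open>ds = speed dt\<close>.
\<close>

definition arc_deriv ::
    "(complex \<Rightarrow> real ^ 2) \<Rightarrow> (real \<Rightarrow> 'a::real_normed_vector) \<Rightarrow> real \<Rightarrow> 'a"
  where "arc_deriv \<gamma> f t = vderiv f t /\<^sub>R speed \<gamma> t"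

definition tangent :: "(complex \<Rightarrow> real ^ 2) \<Rightarrow> real \<Rightarrow> real ^ 2"
  where "tangent \<gamma> = arc_deriv \<gamma> (lift \<gamma>)"

definition normal :: "(complex \<Rightarrow> real ^ 2) \<Rightarrow> real \<Rightarrow> real ^ 2"
  where "normal \<gamma> t = vector [- (tangent \<gamma> t $ 2), tangent \<gamma> t $ 1]"

definition curvature :: "(complex \<Rightarrow> real ^ 2) \<Rightarrow> real \<Rightarrow> real"
  where "curvature \<gamma> t = (arc_deriv \<gamma> ^^ 2) (lift \<gamma>) t \<bullet> normal \<gamma> t"

definition ideal_curve :: "(complex \<Rightarrow> real ^ 2) \<Rightarrow> bool"
  where "ideal_curve \<gamma> \<longleftrightarrow>
    (\<forall>t. (arc_deriv \<gamma> ^^ 4) (curvature \<gamma>) t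
         + (arc_deriv \<gamma> ^^ 2) (curvature \<gamma>) t * (curvature \<gamma> t)\<^sup>2
         - 1 / 2 * (arc_deriv \<gamma> (curvature \<gamma>) t)\<^sup>2 * curvature \<gamma> t = 0)"

text \<open>
  The winding number of the tangent (rotation index); not the library's \<open>winding_number\<close> of a
  path about a point.
\<close>

definition tangent_winding :: "(complex \<Rightarrow> real ^ 2) \<Rightarrow> real"
  where "tangent_winding \<gamma> =
    1 / (2 * pi) * integral {0..2 * pi} (\<lambda>t. curvature \<gamma> t * speed \<gamma> t)"

text \<open>
  ``Covered \<open>\<bar>\<omega>\<bar>\<close> times'' says that every fibre over \<open>sphere x r\<close> has exactly \<open>\<bar>\<omega>\<bar>\<close> points.
  Finiteness is required because \<open>card\<close> of an infinite set is 0; as the fibres are nonempty, \<open>\<omega>\<close> is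
  then a nonzero integer.
\<close>

definition standard_round_circle :: "real \<Rightarrow> (complex \<Rightarrow> real ^ 2) \<Rightarrow> bool"
  where "standard_round_circle \<omega> \<gamma> \<longleftrightarrow>
    smooth_closed_immersed \<gamma> \<and> tangent_winding \<gamma> = \<omega> \<and>
    (\<exists>r>0. \<exists>x. \<gamma> ` unit_circle = sphere x r \<and>
       (\<forall>p\<in>sphere x r. finite {z \<in> unit_circle. \<gamma> z = p} \<and>
                         real (card {z \<in> unit_circle. \<gamma> z = p}) = \<bar>\<omega>\<bar>))"

end

theory Submission
  imports Defs
begin

text \<open>
  The ideal curve equation is the Euler--Lagrange equation of the energy \<open>1/2 \<integral> k\<^sub>s\<^sup>2 ds\<close>. Under the
  dilation \<open>\<gamma> \<mapsto> \<lambda>\<gamma>\<close> this energy is multiplied by \<open>\<lambda>\<close> to the power \<open>-3\<close>; a closed critical point is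
  stationary under dilations as well, so its energy is zero and \<open>k\<close> is constant.

  The argument can be made pointwise. The normal speed of the dilation is the support
  function \<open>p = \<langle>\<gamma>, \<nu>\<rangle>\<close>. Multiplying the equation by \<open>p\<close> and integrating by parts with the
  Frenet equations \<open>p\<^sub>s = -k q\<close>, \<open>q\<^sub>s = 1 + k p\<close>, where \<open>q = \<langle>\<gamma>, \<tau>\<rangle>\<close>, produces a function
  \<open>G = k\<^sub>s\<^sub>s\<^sub>s p + k\<^sub>s\<^sub>s k q - 1/2 k\<^sub>s\<^sup>2 q - k\<^sub>s k\<close> which satisfies \<open>G\<^sub>s = -3/2 k\<^sub>s\<^sup>2\<close> on an ideal curve.
  Since \<open>G\<close> is monotone and periodic it is constant, whence \<open>k\<^sub>s = 0\<close>
  (\<open>ideal_curvature_deriv_eq_0\<close>). The constant curvature \<open>c\<close> is nonzero because otherwise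
  \<open>q\<^sub>s = 1\<close> for the periodic function \<open>q\<close> (\<open>ideal_curvature_constant\<close>).

  The centre \<open>x = \<gamma> + \<nu>/c\<close> is then fixed, and \<open>\<gamma> - x\<close> rotates with angle \<open>\<Phi> = \<integral> c ds\<close>
  (\<open>constant_curvature_parametrization\<close>). One period of the curve turns the angle by
  \<open>2\<pi>\<omega>\<close>, and since the angle is strictly monotone, a point of the circle is hit exactly
  \<open>\<bar>\<omega>\<bar>\<close> times (\<open>card_circle_fibre\<close>).
\<close>

section \<open>Calculus of smooth functions\<close>

text \<open>
  Smoothness asks for iterated derivatives to exist but says nothing about how they combine. The
  truncation to order \<open>n\<close> makes closure properties provable by induction on \<open>n\<close>: the derivative of
  a product, an inverse or a square root is built from functions known to be smooth to one order
  less.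
\<close>

definition smooth_upto :: "nat \<Rightarrow> (real \<Rightarrow> 'a::real_normed_vector) \<Rightarrow> bool"
  where "smooth_upto n f \<longleftrightarrow> (\<forall>m<n. \<forall>t. (vderiv ^^ m) f differentiable (at t))"

lemma smooth_iff_smooth_upto: "smooth f \<longleftrightarrow> (\<forall>n. smooth_upto n f)"
  unfolding smooth_def smooth_upto_def by blast

lemma smooth_upto_0 [simp]: "smooth_upto 0 f"
  by (simp add: smooth_upto_def)

lemma smooth_upto_Suc:
  "smooth_upto (Suc n) f \<longleftrightarrow> (\<forall>t. f differentiable (at t)) \<and> smooth_upto n (vderiv f)"
  unfolding smooth_upto_def All_less_Suc2 by (simp add: funpow_Suc_right del: funpow.simps)

lemma smooth_upto_SucD: "smooth_upto (Suc n) f \<Longrightarrow> smooth_upto n f"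
  by (simp add: smooth_upto_def)

lemma has_vector_derivative_vderiv:
  "f differentiable (at t) \<Longrightarrow> (f has_vector_derivative vderiv f t) (at t)"
  unfolding vderiv_def by (rule vector_derivative_works[THEN iffD1])

lemma smooth_upto_SucI:
  assumes "\<And>t. (f has_vector_derivative f' t) (at t)" and "smooth_upto n f'"
  shows "smooth_upto (Suc n) f"
proof -
  have "vderiv f = f'"
    using assms(1) by (auto simp: vderiv_def vector_derivative_at)
  with assms show ?thesis
    by (auto simp: smooth_upto_Suc intro: differentiableI_vector)
qed

lemma smooth_upto_SucE:
  assumes "smooth_upto (Suc n) f"
  shows "(f has_vector_derivative vderiv f t) (at t)" and "smooth_upto n (vderiv f)"
  using assms by (auto simp: smooth_upto_Suc intro: has_vector_derivative_vderiv)

lemma smooth_upto_linear: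
  assumes "bounded_linear L"
  shows "smooth_upto n f \<Longrightarrow> smooth_upto n (\<lambda>t. L (f t))"
proof (induction n arbitrary: f)
  case (Suc n)
  then show ?case
    by (intro smooth_upto_SucI[OF bounded_linear.has_vector_derivative[OF assms]])
       (auto dest: smooth_upto_SucE)
qed simp

lemma smooth_upto_add:
  "smooth_upto n f \<Longrightarrow> smooth_upto n g \<Longrightarrow> smooth_upto n (\<lambda>t. f t + g t)"
proof (induction n arbitrary: f g)
  case (Suc n)
  then show ?case
    by (intro smooth_upto_SucI[OF has_vector_derivative_add]) (auto dest: smooth_upto_SucE)
qed simp

lemma smooth_upto_bilinear:
  assumes "bounded_bilinear B"
  shows "smooth_upto n f \<Longrightarrow> smooth_upto n g \<Longrightarrow> smooth_upto n (\<lambda>t. B (f t) (g t))"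
proof (induction n arbitrary: f g)
  case (Suc n)
  note d = Suc.prems[THEN smooth_upto_SucE(1)] Suc.prems[THEN smooth_upto_SucE(2)]
    Suc.prems[THEN smooth_upto_SucD]
  show ?case
    by (intro smooth_upto_SucI[OF bounded_bilinear.has_vector_derivative[OF assms d(1,2)]]
          smooth_upto_add Suc.IH d)
qed simp

lemma smooth_upto_inverse:
  fixes f :: "real \<Rightarrow> real"
  shows "smooth_upto n f \<Longrightarrow> (\<And>t. f t \<noteq> 0) \<Longrightarrow> smooth_upto n (\<lambda>t. inverse (f t))"
proof (induction n arbitrary: f)
  case (Suc n)
  note d = smooth_upto_SucE[OF Suc.prems(1)] smooth_upto_SucD[OF Suc.prems(1)]
  note mult = smooth_upto_bilinear[OF bounded_bilinear_mult]
  show ?case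
  proof (rule smooth_upto_SucI)
    show "((\<lambda>t. inverse (f t)) has_vector_derivative
            - 1 * (inverse (f t) * (vderiv f t * inverse (f t)))) (at t)" for t
      using d(1)[of t] Suc.prems(2)[of t]
      unfolding has_real_derivative_iff_has_vector_derivative[symmetric]
      by (auto intro!: derivative_eq_intros)
    show "smooth_upto n (\<lambda>t. - 1 * (inverse (f t) * (vderiv f t * inverse (f t))))"
      by (intro smooth_upto_linear[OF bounded_linear_mult_right] mult Suc.IH d Suc.prems)
  qed
qed simp

lemma smooth_upto_sqrt:
  fixes f :: "real \<Rightarrow> real"
  shows "smooth_upto n f \<Longrightarrow> (\<And>t. f t > 0) \<Longrightarrow> smooth_upto n (\<lambda>t. sqrt (f t))"
proof (induction n arbitrary: f)
  case (Suc n)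
  note d = smooth_upto_SucE[OF Suc.prems(1)] smooth_upto_SucD[OF Suc.prems(1)]
  have pos: "sqrt (f t) \<noteq> 0" for t
    using Suc.prems(2)[of t] by simp
  show ?case
  proof (rule smooth_upto_SucI)
    show "((\<lambda>t. sqrt (f t)) has_vector_derivative
            1 / 2 * (vderiv f t * inverse (sqrt (f t)))) (at t)" for t
      using d(1)[of t] Suc.prems(2)[of t]
      unfolding has_real_derivative_iff_has_vector_derivative[symmetric]
      by (auto intro!: derivative_eq_intros simp: field_simps)
    show "smooth_upto n (\<lambda>t. 1 / 2 * (vderiv f t * inverse (sqrt (f t))))"
      by (intro smooth_upto_linear[OF bounded_linear_mult_right]
            smooth_upto_bilinear[OF bounded_bilinear_mult] smooth_upto_inverse Suc.IH d pos
            Suc.prems)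
  qed
qed simp

lemma smooth_linear: "bounded_linear L \<Longrightarrow> smooth f \<Longrightarrow> smooth (\<lambda>t. L (f t))"
  by (simp add: smooth_iff_smooth_upto smooth_upto_linear)

lemma smooth_bilinear:
  "bounded_bilinear B \<Longrightarrow> smooth f \<Longrightarrow> smooth g \<Longrightarrow> smooth (\<lambda>t. B (f t) (g t))"
  by (simp add: smooth_iff_smooth_upto smooth_upto_bilinear)

lemma smooth_vderiv: "smooth f \<Longrightarrow> smooth (vderiv f)"
  unfolding smooth_iff_smooth_upto using smooth_upto_Suc by blast

lemma smooth_differentiable: "smooth f \<Longrightarrow> f differentiable (at t)"
  unfolding smooth_def by (metis funpow_0)

lemma smooth_continuous: "smooth f \<Longrightarrow> continuous_on A f"
  using smooth_differentiable differentiable_imp_continuous_within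
  by (metis continuous_at_imp_continuous_on)


section \<open>Periodic functions\<close>

definition periodic :: "(real \<Rightarrow> 'a) \<Rightarrow> bool"
  where "periodic f \<longleftrightarrow> (\<forall>t. f (t + 2 * pi) = f t)"

lemma periodic_vderiv:
  assumes "periodic f"
  shows "periodic (vderiv f)"
proof -
  have "(f has_vector_derivative D) (at (t + 2 * pi)) \<longleftrightarrow> (f has_vector_derivative D) (at t)"
    for t D
  proof -
    have "f \<circ> (\<lambda>s. s + 2 * pi) = f"
      using assms by (auto simp: periodic_def)
    moreover have "f \<circ> (\<lambda>s. s - 2 * pi) = f"
    proof
      show "(f \<circ> (\<lambda>s. s - 2 * pi)) s = f s" for s
        using assms[unfolded periodic_def, rule_format, of "s - 2 * pi"] by simp
    qed
    moreover have "((\<lambda>s. s + 2 * pi) has_vector_derivative 1) (at t)"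
      "((\<lambda>s. s - 2 * pi) has_vector_derivative 1) (at (t + 2 * pi))"
      by (auto intro!: derivative_eq_intros)
    ultimately show ?thesis
      using vector_diff_chain_at[of "\<lambda>s. s + 2 * pi" 1 t f D]
        vector_diff_chain_at[of "\<lambda>s. s - 2 * pi" 1 "t + 2 * pi" f D]
      by auto
  qed
  then show ?thesis
    by (simp add: periodic_def vderiv_def vector_derivative_def)
qed

text \<open>
  A nonincreasing function with equal values at \<open>t - \<pi>\<close> and \<open>t + \<pi>\<close> is constant in between. This
  replaces integrating \<open>f'\<close> over a period.
\<close>

lemma periodic_nonpos_derivative_eq_0:
  fixes f f' :: "real \<Rightarrow> real"
  assumes "periodic f"
    and der: "\<And>t. (f has_real_derivative f' t) (at t)" and "\<And>t. f' t \<le> 0"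
  shows "f' t = 0"
proof (rule DERIV_local_const[OF der pi_gt_zero], intro allI impI)
  have mono: "f b \<le> f a" if "a \<le> b" for a b
    by (rule DERIV_nonpos_imp_nonincreasing[OF that]) (use assms in blast)
  have eq: "f (t + pi) = f (t - pi)"
    using assms(1)[unfolded periodic_def, rule_format, of "t - pi"] by (simp add: algebra_simps)
  fix y assume "\<bar>t - y\<bar> < pi"
  then have "t - pi \<le> y" "y \<le> t + pi" by linarith+
  then show "f t = f y"
    using mono[of "t - pi" t] mono[of t "t + pi"] mono[of "t - pi" y] mono[of y "t + pi"] eq
    by simp
qed


section \<open>The Frenet frame of a plane curve\<close>

text \<open>
  The complex structure of the plane. It makes the normal a linear image of the tangent, so that the
  second Frenet equation follows from the first.
\<close>

definition quarter_turn :: "real ^ 2 \<Rightarrow> real ^ 2"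
  where "quarter_turn v = vector [- (v $ 2), v $ 1]"

lemma quarter_turn_nth [simp]: "quarter_turn v $ 1 = - (v $ 2)" "quarter_turn v $ 2 = v $ 1"
  by (simp_all add: quarter_turn_def)

lemma inner_plane: "(v :: real ^ 2) \<bullet> w = v $ 1 * w $ 1 + v $ 2 * w $ 2"
  by (simp add: inner_vec_def sum_2)

lemma bounded_linear_quarter_turn: "bounded_linear quarter_turn"
  by (intro linear_conv_bounded_linear[THEN iffD1] linearI)
     (simp_all add: vec_eq_iff forall_2)

lemma quarter_turn_quarter_turn [simp]: "quarter_turn (quarter_turn v) = - v"
  by (simp add: vec_eq_iff forall_2)

lemma quarter_turn_scaleR [simp]: "quarter_turn (c *\<^sub>R v) = c *\<^sub>R quarter_turn v"
  by (simp add: vec_eq_iff forall_2)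

lemma norm_quarter_turn [simp]: "norm (quarter_turn v) = norm v"
  by (simp add: norm_eq_sqrt_inner inner_plane algebra_simps)

lemma inner_quarter_turn [simp]: "v \<bullet> quarter_turn v = 0"
  by (simp add: inner_plane)

lemma normal_eq_quarter_turn: "normal \<gamma> t = quarter_turn (tangent \<gamma> t)"
  by (simp add: normal_def quarter_turn_def)

lemma unit_normal_component:
  assumes "norm v = 1" and "u \<bullet> v = 0"
  shows "u = (u \<bullet> quarter_turn v) *\<^sub>R quarter_turn v"
proof -
  have 1: "v $ 1 * v $ 1 + v $ 2 * v $ 2 = 1"
    using assms(1) by (simp add: norm_eq_sqrt_inner inner_plane)
  have 2: "u $ 1 * v $ 1 + u $ 2 * v $ 2 = 0"
    using assms(2) by (simp add: inner_plane)
  show ?thesis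
    unfolding vec_eq_iff forall_2
    using 1 2 by (simp add: inner_plane) algebra
qed

locale immersed_curve =
  fixes \<gamma> :: "complex \<Rightarrow> real ^ 2"
  assumes immersed: "smooth_closed_immersed \<gamma>"
begin

lemma smooth_lift: "smooth (lift \<gamma>)"
  using immersed by (simp add: smooth_closed_immersed_def)

lemma speed_pos: "0 < speed \<gamma> t"
  using immersed by (simp add: smooth_closed_immersed_def speed_def)

lemma speed_neq_0 [simp]: "speed \<gamma> t \<noteq> 0"
  using speed_pos[of t] by simp

lemma smooth_speed: "smooth (speed \<gamma>)"
proof -
  have "smooth (\<lambda>t. vderiv (lift \<gamma>) t \<bullet> vderiv (lift \<gamma>) t)"
    by (intro smooth_bilinear[OF bounded_bilinear_inner] smooth_vderiv smooth_lift)
  moreover have "0 < vderiv (lift \<gamma>) t \<bullet> vderiv (lift \<gamma>) t" for t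
    using speed_pos[of t] by (simp add: speed_def)
  ultimately have "smooth (\<lambda>t. sqrt (vderiv (lift \<gamma>) t \<bullet> vderiv (lift \<gamma>) t))"
    by (simp add: smooth_iff_smooth_upto smooth_upto_sqrt)
  then show ?thesis
    by (simp add: speed_def[abs_def] norm_eq_sqrt_inner)
qed

lemma smooth_arc_deriv: "smooth f \<Longrightarrow> smooth (arc_deriv \<gamma> f)"
  using smooth_speed smooth_upto_inverse[of _ "speed \<gamma>"]
    smooth_bilinear[OF bounded_bilinear_scaleR, of "\<lambda>t. inverse (speed \<gamma> t)" "vderiv f"]
    smooth_vderiv[of f]
  by (simp add: arc_deriv_def[abs_def] smooth_iff_smooth_upto)

lemma has_vector_derivative_arc_deriv:
  "smooth f \<Longrightarrow> (f has_vector_derivative speed \<gamma> t *\<^sub>R arc_deriv \<gamma> f t) (at t)"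
  using has_vector_derivative_vderiv[OF smooth_differentiable, of f t]
  by (simp add: arc_deriv_def)

lemma smooth_tangent: "smooth (tangent \<gamma>)"
  unfolding tangent_def by (intro smooth_arc_deriv smooth_lift)

lemma smooth_normal: "smooth (normal \<gamma>)"
  using smooth_linear[OF bounded_linear_quarter_turn smooth_tangent]
  by (simp add: normal_eq_quarter_turn[abs_def])

lemma curvature_eq: "curvature \<gamma> = (\<lambda>t. arc_deriv \<gamma> (tangent \<gamma>) t \<bullet> normal \<gamma> t)"
  by (simp add: curvature_def[abs_def] tangent_def numeral_2_eq_2)

lemma smooth_curvature: "smooth (curvature \<gamma>)"
  unfolding curvature_eq
  by (intro smooth_bilinear[OF bounded_bilinear_inner] smooth_arc_deriv smooth_tangent smooth_normal)

lemma norm_tangent [simp]: "norm (tangent \<gamma> t) = 1"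
  using speed_pos[of t] by (simp add: tangent_def arc_deriv_def speed_def)

lemma tangent_inner_tangent [simp]: "tangent \<gamma> t \<bullet> tangent \<gamma> t = 1"
  by (simp add: dot_square_norm)

lemma lift_has_derivative: "(lift \<gamma> has_vector_derivative speed \<gamma> t *\<^sub>R tangent \<gamma> t) (at t)"
  unfolding tangent_def by (intro has_vector_derivative_arc_deriv smooth_lift)

text \<open>
  The first Frenet equation: differentiating \<open>\<langle>\<tau>, \<tau>\<rangle> = 1\<close> shows that \<open>\<tau>\<^sub>s\<close> is normal, and in the plane
  a normal vector is determined by its component along \<open>\<nu>\<close>.
\<close>

lemma arc_deriv_tangent: "arc_deriv \<gamma> (tangent \<gamma>) t = curvature \<gamma> t *\<^sub>R normal \<gamma> t"
proof -
  let ?a = "arc_deriv \<gamma> (tangent \<gamma>) t"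
  have d: "(tangent \<gamma> has_vector_derivative speed \<gamma> t *\<^sub>R ?a) (at t)"
    by (intro has_vector_derivative_arc_deriv smooth_tangent)
  have "((\<lambda>t. tangent \<gamma> t \<bullet> tangent \<gamma> t) has_vector_derivative
      2 * speed \<gamma> t * (?a \<bullet> tangent \<gamma> t)) (at t)"
    using bounded_bilinear.has_vector_derivative[OF bounded_bilinear_inner d d]
    by (simp add: inner_commute algebra_simps)
  then have "((\<lambda>t. 1) has_vector_derivative 2 * speed \<gamma> t * (?a \<bullet> tangent \<gamma> t)) (at t)"
    by simp
  from vector_derivative_unique_at[OF this has_vector_derivative_const]
  have "?a \<bullet> tangent \<gamma> t = 0"
    by simp
  from unit_normal_component[OF norm_tangent this] show ?thesis
    by (simp add: curvature_eq normal_eq_quarter_turn)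
qed

lemma tangent_has_derivative:
  "(tangent \<gamma> has_vector_derivative (speed \<gamma> t * curvature \<gamma> t) *\<^sub>R normal \<gamma> t) (at t)"
  using has_vector_derivative_arc_deriv[OF smooth_tangent, of t] by (simp add: arc_deriv_tangent)

lemma normal_has_derivative:
  "(normal \<gamma> has_vector_derivative - ((speed \<gamma> t * curvature \<gamma> t) *\<^sub>R tangent \<gamma> t)) (at t)"
  using bounded_linear.has_vector_derivative[OF bounded_linear_quarter_turn tangent_has_derivative, of t]
  by (simp add: normal_eq_quarter_turn[abs_def])

lemma support_has_derivative:
  "((\<lambda>t. lift \<gamma> t \<bullet> normal \<gamma> t) has_real_derivative
     speed \<gamma> t * (- (curvature \<gamma> t * (lift \<gamma> t \<bullet> tangent \<gamma> t)))) (at t)"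
  using bounded_bilinear.has_vector_derivative[OF bounded_bilinear_inner lift_has_derivative
      normal_has_derivative, of t]
  unfolding has_real_derivative_iff_has_vector_derivative
  by (simp add: normal_eq_quarter_turn mult.assoc)

lemma tangential_has_derivative:
  "((\<lambda>t. lift \<gamma> t \<bullet> tangent \<gamma> t) has_real_derivative
     speed \<gamma> t * (1 + curvature \<gamma> t * (lift \<gamma> t \<bullet> normal \<gamma> t))) (at t)"
  using bounded_bilinear.has_vector_derivative[OF bounded_bilinear_inner lift_has_derivative
      tangent_has_derivative, of t]
  unfolding has_real_derivative_iff_has_vector_derivative
  by (simp add: algebra_simps)

lemma periodic_lift: "periodic (lift \<gamma>)"
  by (simp add: periodic_def lift_def cis_mult[symmetric])

lemma periodic_speed: "periodic (speed \<gamma>)"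
  using periodic_vderiv[OF periodic_lift] by (simp add: periodic_def speed_def)

lemma periodic_arc_deriv: "periodic f \<Longrightarrow> periodic (arc_deriv \<gamma> f)"
  using periodic_vderiv[of f] periodic_speed by (simp add: periodic_def arc_deriv_def)

lemma periodic_tangent: "periodic (tangent \<gamma>)"
  unfolding tangent_def by (intro periodic_arc_deriv periodic_lift)

lemma periodic_normal: "periodic (normal \<gamma>)"
  using periodic_tangent by (simp add: periodic_def normal_def)

lemma periodic_curvature: "periodic (curvature \<gamma>)"
  using periodic_arc_deriv[OF periodic_tangent] periodic_normal
  by (simp add: curvature_eq periodic_def)


section \<open>Ideal curves have constant curvature\<close>

text \<open>
  The function \<open>G\<close> below collects the boundary terms in the partial integration of
  \<open>(k\<^sub>s\<^sub>s\<^sub>s\<^sub>s + k\<^sub>s\<^sub>s k\<^sup>2) p\<close>. The terms are found one after the other: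
  \<open>k\<^sub>s\<^sub>s\<^sub>s\<^sub>s p = (k\<^sub>s\<^sub>s\<^sub>s p)\<^sub>s + k\<^sub>s\<^sub>s\<^sub>s k q\<close>, then
  \<open>k\<^sub>s\<^sub>s\<^sub>s k q = (k\<^sub>s\<^sub>s k q)\<^sub>s - k\<^sub>s\<^sub>s k\<^sub>s q - k\<^sub>s\<^sub>s k - k\<^sub>s\<^sub>s k\<^sup>2 p\<close>, and finally
  \<open>- k\<^sub>s\<^sub>s k\<^sub>s q = - (1/2 k\<^sub>s\<^sup>2 q)\<^sub>s + 1/2 k\<^sub>s\<^sup>2 (1 + k p)\<close> and \<open>- k\<^sub>s\<^sub>s k = - (k\<^sub>s k)\<^sub>s + k\<^sub>s\<^sup>2\<close>.
  What is left over is \<open>1/2 k\<^sub>s\<^sup>2 k p\<close>, which the ideal curve equation cancels, and \<open>3/2 k\<^sub>s\<^sup>2\<close>.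
\<close>

lemma ideal_curvature_deriv_eq_0:
  assumes "ideal_curve \<gamma>"
  shows "arc_deriv \<gamma> (curvature \<gamma>) t = 0"
proof -
  define k where "k = (\<lambda>n. (arc_deriv \<gamma> ^^ n) (curvature \<gamma>))"
  define p where "p = (\<lambda>t. lift \<gamma> t \<bullet> normal \<gamma> t)"
  define q where "q = (\<lambda>t. lift \<gamma> t \<bullet> tangent \<gamma> t)"
  define G where "G = (\<lambda>t. k 3 t * p t + k 2 t * k 0 t * q t - 1 / 2 * (k 1 t)\<^sup>2 * q t - k 1 t * k 0 t)"
  have k_smooth: "smooth (k n)" for n
    by (induction n) (simp_all add: k_def smooth_curvature smooth_arc_deriv)
  have k_periodic: "periodic (k n)" for n
    by (induction n) (simp_all add: k_def periodic_curvature periodic_arc_deriv)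
  have k_der: "(k n has_real_derivative speed \<gamma> t * k (Suc n) t) (at t)" for n t
    using has_vector_derivative_arc_deriv[OF k_smooth, of n t]
    by (simp add: has_real_derivative_iff_has_vector_derivative k_def)
  have k_ders: "(k 0 has_real_derivative speed \<gamma> t * k 1 t) (at t)"
    "(k 1 has_real_derivative speed \<gamma> t * k 2 t) (at t)"
    "(k 2 has_real_derivative speed \<gamma> t * k 3 t) (at t)"
    "(k 3 has_real_derivative speed \<gamma> t * k 4 t) (at t)" for t
    using k_der[of 0 t] k_der[of 1 t] k_der[of 2 t] k_der[of 3 t]
    by (simp_all add: eval_nat_numeral)
  have p_der: "(p has_real_derivative speed \<gamma> t * (- (k 0 t * q t))) (at t)" for t
    using support_has_derivative[of t] by (simp add: p_def q_def k_def)
  have q_der: "(q has_real_derivative speed \<gamma> t * (1 + k 0 t * p t)) (at t)" for t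
    using tangential_has_derivative[of t] by (simp add: p_def q_def k_def)
  have "k 4 t + k 2 t * (k 0 t)\<^sup>2 - 1 / 2 * (k 1 t)\<^sup>2 * k 0 t = 0" for t
    using assms by (simp add: ideal_curve_def k_def)
  then have F: "k 4 t = 1 / 2 * (k 1 t)\<^sup>2 * k 0 t - k 2 t * (k 0 t)\<^sup>2" for t
    by (simp add: algebra_simps eq_diff_eq)
  have G_der: "(G has_real_derivative - (3 / 2 * speed \<gamma> t * (k 1 t)\<^sup>2)) (at t)" for t
    unfolding G_def
    by (rule derivative_eq_intros k_ders p_der q_der refl)+
       (simp add: F algebra_simps power2_eq_square)
  have G_periodic: "periodic G"
    using k_periodic periodic_lift periodic_tangent periodic_normal
    by (simp add: G_def p_def q_def periodic_def)
  have "- (3 / 2 * speed \<gamma> t * (k 1 t)\<^sup>2) \<le> 0" for t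
    using speed_pos[of t] by simp
  from periodic_nonpos_derivative_eq_0[OF G_periodic G_der this]
  have "- (3 / 2 * speed \<gamma> t * (k 1 t)\<^sup>2) = 0" .
  then show ?thesis
    by (simp add: k_def)
qed

lemma ideal_curvature_constant:
  assumes "ideal_curve \<gamma>"
  obtains c where "c \<noteq> 0" and "\<And>t. curvature \<gamma> t = c"
proof
  have "(curvature \<gamma> has_real_derivative 0) (at t)" for t
    using has_vector_derivative_arc_deriv[OF smooth_curvature, of t]
    by (simp add: has_real_derivative_iff_has_vector_derivative ideal_curvature_deriv_eq_0[OF assms])
  then show const: "curvature \<gamma> t = curvature \<gamma> 0" for t
    by (intro DERIV_isconst_all) auto
  \<comment> \<open>If \<open>k\<close> vanishes the curve is a straight line, along which \<open>\<langle>\<gamma>, \<tau>\<rangle>\<close> grows like arc length.\<close>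
  show "curvature \<gamma> 0 \<noteq> 0"
  proof
    assume "curvature \<gamma> 0 = 0"
    then have "((\<lambda>t. - (lift \<gamma> t \<bullet> tangent \<gamma> t)) has_real_derivative - speed \<gamma> t) (at t)" for t
      using DERIV_minus[OF tangential_has_derivative[of t]] const[of t] by simp
    moreover have "periodic (\<lambda>t. - (lift \<gamma> t \<bullet> tangent \<gamma> t))"
      using periodic_lift periodic_tangent by (simp add: periodic_def)
    moreover have "- speed \<gamma> t \<le> 0" for t
      using speed_pos[of t] by simp
    ultimately have "- speed \<gamma> 0 = 0"
      by (intro periodic_nonpos_derivative_eq_0)
    then show False by simp
  qed
qed


text \<open>
  The vector \<open>w = \<gamma> - x\<close> from the centre \<open>x = \<gamma> + \<nu>/c\<close> satisfies the linear equation
  \<open>w' = \<Phi>' J w\<close>, with \<open>J\<close> the quarter turn. Its solution is the rotation by \<open>\<Phi>\<close>.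
\<close>

lemma constant_curvature_parametrization:
  assumes "c \<noteq> 0" and curv: "\<And>t. curvature \<gamma> t = c"
    and \<Phi>: "\<And>t. t \<in> {0..2 * pi} \<Longrightarrow>
      (\<Phi> has_real_derivative c * speed \<gamma> t) (at t within {0..2 * pi})"
    and "\<Phi> 0 = 0"
  obtains x u where "u \<noteq> 0" and "\<And>t. t \<in> {0..2 * pi} \<Longrightarrow>
    lift \<gamma> t = x + cos (\<Phi> t) *\<^sub>R u + sin (\<Phi> t) *\<^sub>R quarter_turn u"
proof -
  have "((\<lambda>t. lift \<gamma> t + (1 / c) *\<^sub>R normal \<gamma> t) has_vector_derivative 0) (at t)" for t
    using has_vector_derivative_add[OF lift_has_derivative bounded_linear.has_vector_derivative[OF
          bounded_linear_scaleR_right normal_has_derivative, of "1 / c"], of t] assms(1)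
    by (simp add: curv)
  then obtain x where x: "lift \<gamma> t + (1 / c) *\<^sub>R normal \<gamma> t = x" for t
    by (rule has_vector_derivative_zero_constant[OF convex_UNIV]) auto
  define w where "w = (\<lambda>t. lift \<gamma> t - x)"
  have w: "w t = - ((1 / c) *\<^sub>R normal \<gamma> t)" for t
    using x[of t] by (simp add: w_def algebra_simps)
  have tangent_eq: "tangent \<gamma> t = c *\<^sub>R quarter_turn (w t)" for t
    using assms(1) by (simp add: w normal_eq_quarter_turn vec_eq_iff forall_2)
  have w_der: "(w has_vector_derivative (c * speed \<gamma> t) *\<^sub>R quarter_turn (w t)) (at t within A)"
    for t A
    unfolding w_def using has_vector_derivative_at_within[OF lift_has_derivative, of t A]
    by (auto intro!: derivative_eq_intros simp: tangent_eq w_def mult.commute)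
  have Jw_der: "((\<lambda>t. quarter_turn (w t)) has_vector_derivative - (c * speed \<gamma> t) *\<^sub>R w t) (at t within A)"
    for t A
    using bounded_linear.has_vector_derivative[OF bounded_linear_quarter_turn w_der, of t A] by simp
  \<comment> \<open>Turning \<open>w\<close> back by the angle \<open>\<Phi>\<close> gives a vector that does not move.\<close>
  define z where "z = (\<lambda>t. cos (\<Phi> t) *\<^sub>R w t - sin (\<Phi> t) *\<^sub>R quarter_turn (w t))"
  have "(z has_vector_derivative 0) (at t within {0..2 * pi})" if "t \<in> {0..2 * pi}" for t
  proof -
    have "((\<lambda>t. cos (\<Phi> t)) has_real_derivative - sin (\<Phi> t) * (c * speed \<gamma> t)) (at t within {0..2 * pi})"
      "((\<lambda>t. sin (\<Phi> t)) has_real_derivative cos (\<Phi> t) * (c * speed \<gamma> t)) (at t within {0..2 * pi})"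
      using \<Phi>[OF that] by (auto intro!: derivative_eq_intros)
    note d = has_vector_derivative_diff[OF has_vector_derivative_scaleR[OF this(1) w_der]
        has_vector_derivative_scaleR[OF this(2) Jw_der]]
    show ?thesis
      unfolding z_def by (rule has_vector_derivative_eq_rhs[OF d]) (simp add: algebra_simps)
  qed
  then obtain u where u: "z t = u" if "t \<in> {0..2 * pi}" for t
    by (rule has_vector_derivative_zero_constant[OF convex_real_interval(5)]) auto
  show ?thesis
  proof
    have "norm (w 0) = \<bar>1 / c\<bar>"
      by (simp add: w normal_eq_quarter_turn)
    moreover have "u = w 0"
      using u[of 0] \<open>\<Phi> 0 = 0\<close> by (simp add: z_def)
    ultimately show "u \<noteq> 0"
      using assms(1) by auto
    fix t :: real assume t: "t \<in> {0..2 * pi}"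
    have "cos (\<Phi> t) *\<^sub>R z t + sin (\<Phi> t) *\<^sub>R quarter_turn (z t) = w t"
      using sin_cos_squared_add[of "\<Phi> t"] unfolding z_def vec_eq_iff forall_2
      by (simp, intro conjI; algebra)
    then show "lift \<gamma> t = x + cos (\<Phi> t) *\<^sub>R u + sin (\<Phi> t) *\<^sub>R quarter_turn u"
      by (simp add: u[OF t] w_def algebra_simps)
  qed
qed

end


section \<open>Counting the fibres of a circle parametrization\<close>

text \<open>
  The factor \<open>\<epsilon> = \<plusminus>1\<close> here and below is the orientation in which the circle is traversed. Carrying it
  along lets the angle always be increasing, so that clockwise curves need no separate count.
\<close>

lemma plane_polar_form:
  assumes "norm d = norm u" and "u \<noteq> (0 :: real ^ 2)" and "\<epsilon>\<^sup>2 = 1"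
  obtains \<alpha> where "0 \<le> \<alpha>" "\<alpha> < 2 * pi"
    "d = cos \<alpha> *\<^sub>R u + (\<epsilon> * sin \<alpha>) *\<^sub>R quarter_turn u"
proof -
  define a b where "a = (d \<bullet> u) / (u \<bullet> u)" and "b = (d \<bullet> quarter_turn u) / (u \<bullet> u)"
  have u: "u \<bullet> u \<noteq> 0" "u $ 1 * u $ 1 + u $ 2 * u $ 2 \<noteq> 0"
    using assms(2) by (simp_all flip: inner_plane)
  have d: "d \<bullet> d = u \<bullet> u"
    using assms(1) by (simp add: dot_square_norm)
  have ab: "a * (u \<bullet> u) = d \<bullet> u" "b * (u \<bullet> u) = d \<bullet> quarter_turn u"
    using u by (simp_all add: a_def b_def)
  have eq: "d = a *\<^sub>R u + b *\<^sub>R quarter_turn u"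
  proof -
    have "(u \<bullet> u) *\<^sub>R d = (a * (u \<bullet> u)) *\<^sub>R u + (b * (u \<bullet> u)) *\<^sub>R quarter_turn u"
      unfolding ab vec_eq_iff forall_2 by (simp add: inner_plane algebra_simps)
    also have "\<dots> = (u \<bullet> u) *\<^sub>R (a *\<^sub>R u + b *\<^sub>R quarter_turn u)"
      by (simp add: algebra_simps)
    finally show ?thesis
      using u by simp
  qed
  have "(a\<^sup>2 + b\<^sup>2) * (u \<bullet> u) = d \<bullet> d"
    unfolding eq by (simp add: inner_plane algebra_simps power2_eq_square)
  then have "a\<^sup>2 + (\<epsilon> * b)\<^sup>2 = 1"
    using u d assms(3) by (simp add: power_mult_distrib)
  then obtain \<alpha> where \<alpha>: "0 \<le> \<alpha>" "\<alpha> < 2 * pi" "a = cos \<alpha>" "\<epsilon> * b = sin \<alpha>"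
    by (rule sincos_total_2pi)
  have "\<epsilon> * sin \<alpha> = b"
    using \<alpha>(4)[symmetric] assms(3) by (simp add: power2_eq_square flip: mult.assoc)
  with \<alpha> eq show ?thesis
    by (intro that[of \<alpha>]) auto
qed

lemma rotated_vector_eq_iff:
  assumes "u \<noteq> (0 :: real ^ 2)"
  shows "a *\<^sub>R u + b *\<^sub>R quarter_turn u = a' *\<^sub>R u + b' *\<^sub>R quarter_turn u \<longleftrightarrow> a = a' \<and> b = b'"
proof
  assume *: "a *\<^sub>R u + b *\<^sub>R quarter_turn u = a' *\<^sub>R u + b' *\<^sub>R quarter_turn u"
  have u: "u $ 1 * u $ 1 + u $ 2 * u $ 2 \<noteq> 0"
    using assms by (simp flip: inner_plane)
  have "a * u $ 1 - b * u $ 2 = a' * u $ 1 - b' * u $ 2" "a * u $ 2 + b * u $ 1 = a' * u $ 2 + b' * u $ 1"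
    using * by (simp_all add: vec_eq_iff forall_2)
  then have "(a - a') * (u $ 1 * u $ 1 + u $ 2 * u $ 2) = 0" "(b - b') * (u $ 1 * u $ 1 + u $ 2 * u $ 2) = 0"
    by algebra+
  with u show "a = a' \<and> b = b'"
    by (metis eq_iff_diff_eq_0 mult_eq_0_iff)
qed simp

lemma norm_rotated_vector:
  assumes "\<epsilon>\<^sup>2 = 1"
  shows "norm (cos \<alpha> *\<^sub>R u + (\<epsilon> * sin \<alpha>) *\<^sub>R quarter_turn u) = norm u"
proof -
  have "(\<epsilon> * sin \<alpha>)\<^sup>2 + (cos \<alpha>)\<^sup>2 = 1"
    using assms by (simp add: power_mult_distrib)
  then show ?thesis
    unfolding norm_eq_sqrt_inner real_sqrt_eq_iff inner_plane
    by (simp, algebra)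
qed

text \<open>
  The angles of a given direction in \<open>[0, 2\<pi>m)\<close> are \<open>\<alpha> + 2\<pi>j\<close> with \<open>0 \<le> j < m\<close>; this uses that
  \<open>\<alpha>\<close> is reduced to \<open>[0, 2\<pi>)\<close>.
\<close>

lemma card_angle_fibre:
  fixes \<alpha> :: real
  assumes "0 \<le> \<alpha>" "\<alpha> < 2 * pi"
  shows "finite {s \<in> {0..<2 * pi * real m}. \<exists>j::int. s = \<alpha> + 2 * pi * j}"
    and "card {s \<in> {0..<2 * pi * real m}. \<exists>j::int. s = \<alpha> + 2 * pi * j} = m"
proof -
  have range: "\<alpha> + 2 * pi * real_of_int j \<in> {0..<2 * pi * real m} \<longleftrightarrow> j \<in> {0..<int m}" for j
  proof -
    define \<beta> where "\<beta> = \<alpha> / (2 * pi)"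
    have \<beta>: "0 \<le> \<beta>" "\<beta> < 1" and \<alpha>: "\<alpha> = 2 * pi * \<beta>"
      using assms by (auto simp: \<beta>_def)
    have "\<alpha> + 2 * pi * real_of_int j \<in> {0..<2 * pi * real m} \<longleftrightarrow> 0 \<le> \<beta> + j \<and> \<beta> + j < real m"
      by (simp add: \<alpha> zero_le_mult_iff not_le[THEN iffD2, OF pi_gt_zero] flip: distrib_left)
    also have "\<dots> \<longleftrightarrow> 0 \<le> j \<and> j < int m"
      using \<beta> by linarith
    finally show ?thesis by simp
  qed
  have "{s \<in> {0..<2 * pi * real m}. \<exists>j::int. s = \<alpha> + 2 * pi * j} =
      (\<lambda>j. \<alpha> + 2 * pi * real_of_int j) ` {0..<int m}"
    using range by blast
  moreover have "inj_on (\<lambda>j. \<alpha> + 2 * pi * real_of_int j) {0..<int m}"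
    by (auto simp: inj_on_def)
  ultimately show "finite {s \<in> {0..<2 * pi * real m}. \<exists>j::int. s = \<alpha> + 2 * pi * j}"
    and "card {s \<in> {0..<2 * pi * real m}. \<exists>j::int. s = \<alpha> + 2 * pi * j} = m"
    by (simp_all add: card_image)
qed

lemma bij_betw_cis_unit_circle: "bij_betw cis {0..<2 * pi} unit_circle"
proof (intro bij_betw_imageI)
  show "inj_on cis {0..<2 * pi}"
  proof
    fix a b :: real assume ab: "a \<in> {0..<2 * pi}" "b \<in> {0..<2 * pi}" "cis a = cis b"
    then obtain n :: int where n: "a = b + 2 * pi * n"
      using sin_cos_eq_iff[of a b] by (auto simp: complex_eq_iff)
    then have "2 * pi * real_of_int n < 2 * pi * 1" "2 * pi * (- 1) < 2 * pi * real_of_int n"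
      using ab(1,2) unfolding atLeastLessThan_iff by linarith+
    then have "real_of_int n < 1" "- 1 < real_of_int n"
      unfolding mult_less_cancel_left_pos[OF mult_pos_pos[OF zero_less_numeral pi_gt_zero]] .
    then have "n = 0" by simp
    with n show "a = b" by simp
  qed
  show "cis ` {0..<2 * pi} = unit_circle"
  proof
    show "unit_circle \<subseteq> cis ` {0..<2 * pi}"
    proof
      fix z :: complex assume "z \<in> unit_circle"
      then have "(Re z)\<^sup>2 + (Im z)\<^sup>2 = 1"
        by (simp flip: cmod_power2)
      then show "z \<in> cis ` {0..<2 * pi}"
      proof (rule sincos_total_2pi)
        fix t assume "0 \<le> t" "t < 2 * pi" "Re z = cos t" "Im z = sin t"
        then show ?thesis
          by (intro image_eqI[of _ _ t]) (simp_all add: complex_eq_iff)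
      qed
    qed
  qed auto
qed

text \<open>
  By the intermediate value theorem the increasing angle \<open>\<phi>\<close> is a bijection from \<open>[0, 2\<pi>)\<close> to
  \<open>[0, 2\<pi>m)\<close>, so the parameters mapped to \<open>p\<close> correspond to the angles in \<open>[0, 2\<pi>m)\<close> with the
  direction of \<open>p - x\<close>.
\<close>

lemma card_circle_fibre:
  fixes f :: "complex \<Rightarrow> real ^ 2"
  assumes cont: "continuous_on {0..2 * pi} \<phi>" and mono: "strict_mono_on {0..2 * pi} \<phi>"
    and ends: "\<phi> 0 = 0" "\<phi> (2 * pi) = 2 * pi * real m"
    and u: "u \<noteq> 0" and \<epsilon>: "\<epsilon>\<^sup>2 = 1"
    and f: "\<And>t. t \<in> {0..2 * pi} \<Longrightarrow>
      f (cis t) = x + cos (\<phi> t) *\<^sub>R u + (\<epsilon> * sin (\<phi> t)) *\<^sub>R quarter_turn u"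
    and p: "p \<in> sphere x (norm u)"
  shows "finite {z \<in> unit_circle. f z = p} \<and> card {z \<in> unit_circle. f z = p} = m"
proof -
  have "norm (p - x) = norm u"
    using p by (simp add: dist_norm norm_minus_commute)
  then obtain \<alpha> where \<alpha>: "0 \<le> \<alpha>" "\<alpha> < 2 * pi"
    "p - x = cos \<alpha> *\<^sub>R u + (\<epsilon> * sin \<alpha>) *\<^sub>R quarter_turn u"
    using u \<epsilon> by (rule plane_polar_form)
  define T where "T = {t \<in> {0..<2 * pi}. f (cis t) = p}"
  define S where "S = {s \<in> {0..<2 * pi * real m}. \<exists>j::int. s = \<alpha> + 2 * pi * j}"
  have fibre: "f (cis t) = p \<longleftrightarrow> (\<exists>j::int. \<phi> t = \<alpha> + 2 * pi * j)" if "t \<in> {0..<2 * pi}" for t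
  proof -
    have "f (cis t) = p \<longleftrightarrow> f (cis t) - x = p - x" by simp
    also have "\<dots> \<longleftrightarrow> cos (\<phi> t) *\<^sub>R u + (\<epsilon> * sin (\<phi> t)) *\<^sub>R quarter_turn u =
        cos \<alpha> *\<^sub>R u + (\<epsilon> * sin \<alpha>) *\<^sub>R quarter_turn u"
      using that unfolding \<alpha>(3) by (simp add: f)
    also have "\<dots> \<longleftrightarrow> sin (\<phi> t) = sin \<alpha> \<and> cos (\<phi> t) = cos \<alpha>"
      using \<epsilon> by (auto simp: rotated_vector_eq_iff[OF u])
    also have "\<dots> \<longleftrightarrow> (\<exists>j::int. \<phi> t = \<alpha> + 2 * pi * j)"
      by (rule sin_cos_eq_iff)
    finally show ?thesis .
  qed
  have "\<phi> ` T = S"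
  proof
    show "\<phi> ` T \<subseteq> S"
    proof safe
      fix t assume t: "t \<in> T"
      then have "t \<in> {0..<2 * pi}" by (simp add: T_def)
      then have "\<phi> 0 \<le> \<phi> t" "\<phi> t < \<phi> (2 * pi)"
        using strict_mono_onD[OF mono, of t "2 * pi"] strict_mono_on_leD[OF mono, of 0 t] by auto
      then show "\<phi> t \<in> S"
        using t fibre by (auto simp: T_def S_def ends)
    qed
    show "S \<subseteq> \<phi> ` T"
    proof
      fix s assume s: "s \<in> S"
      then have "\<phi> 0 \<le> s" "s < \<phi> (2 * pi)" by (auto simp: S_def ends)
      then obtain t where t: "0 \<le> t" "t \<le> 2 * pi" "\<phi> t = s"
        using IVT'[of \<phi> 0 s "2 * pi"] cont by auto
      moreover have "t \<noteq> 2 * pi"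
        using t \<open>s < \<phi> (2 * pi)\<close> by auto
      ultimately have "t \<in> T"
        using fibre[of t] s by (auto simp: T_def S_def)
      with t show "s \<in> \<phi> ` T" by blast
    qed
  qed
  moreover have "inj_on \<phi> T"
    using strict_mono_on_imp_inj_on[OF mono] by (rule inj_on_subset) (auto simp: T_def)
  ultimately have "bij_betw \<phi> T S"
    by (simp add: bij_betw_def)
  then have T: "finite T" "card T = m"
    using card_angle_fibre[OF \<alpha>(1,2), of m, folded S_def] bij_betw_finite[of \<phi> T S]
      bij_betw_same_card[of \<phi> T S]
    by simp_all
  have "{z \<in> unit_circle. f z = p} = cis ` T"
    unfolding T_def bij_betw_imp_surj_on[OF bij_betw_cis_unit_circle, symmetric] by blast
  moreover have "inj_on cis T"
    using bij_betw_imp_inj_on[OF bij_betw_cis_unit_circle] by (rule inj_on_subset) (auto simp: T_def)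
  ultimately show ?thesis using T
    by (simp add: card_image)
qed


section \<open>Closed ideal curves are round circles\<close>

theorem theorem5p1:
  fixes \<gamma> :: "complex \<Rightarrow> real ^ 2"
  assumes "smooth_closed_immersed \<gamma>"
    and "ideal_curve \<gamma>"
  shows "(\<exists>r>0. \<exists>x. \<gamma> ` unit_circle = sphere x r) \<and>
         standard_round_circle (tangent_winding \<gamma>) \<gamma>"
proof -
  interpret immersed_curve \<gamma> by unfold_locales (rule assms)
  let ?I = "{0..2 * pi}"
  obtain c where c: "c \<noteq> 0" "curvature \<gamma> t = c" for t
    using ideal_curvature_constant[OF assms(2)] by blast
  define \<Phi> where "\<Phi> = (\<lambda>t. integral {0..t} (\<lambda>t. c * speed \<gamma> t))"
  have \<Phi>_der: "(\<Phi> has_real_derivative c * speed \<gamma> t) (at t within ?I)" if "t \<in> ?I" for t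
    unfolding \<Phi>_def has_real_derivative_iff_has_vector_derivative
    by (intro integral_has_vector_derivative continuous_on_mult_left smooth_continuous smooth_speed that)
  have \<Phi>_0: "\<Phi> 0 = 0" by (simp add: \<Phi>_def)
  obtain x u where u: "u \<noteq> 0"
    and param: "\<And>t. t \<in> ?I \<Longrightarrow>
      lift \<gamma> t = x + cos (\<Phi> t) *\<^sub>R u + sin (\<Phi> t) *\<^sub>R quarter_turn u"
    using constant_curvature_parametrization[OF c \<Phi>_der \<Phi>_0] by blast
  \<comment> \<open>The unsigned turning angle; the sign of \<open>c\<close> is moved to the orientation of the circle.\<close>
  define \<phi> where "\<phi> = (\<lambda>t. sgn c * \<Phi> t)"
  have sgn: "(sgn c)\<^sup>2 = 1"
    using c(1) by (simp add: sgn_if)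
  have trig: "cos (\<Phi> t) = cos (\<phi> t)" "sin (\<Phi> t) = sgn c * sin (\<phi> t)" for t
    using c(1) by (auto simp: \<phi>_def sgn_if)
  have \<phi>_der: "(\<phi> has_real_derivative \<bar>c\<bar> * speed \<gamma> t) (at t within ?I)" if "t \<in> ?I" for t
    using DERIV_cmult[OF \<Phi>_der[OF that], of "sgn c"] by (simp add: \<phi>_def abs_sgn algebra_simps)
  have cont: "continuous_on ?I \<phi>"
    using \<phi>_der by (rule DERIV_continuous_on)
  have mono: "strict_mono_on ?I \<phi>"
  proof (rule strict_mono_onI)
    fix a b assume ab: "a \<in> ?I" "b \<in> ?I" "a < b"
    show "\<phi> a < \<phi> b"
    proof (rule DERIV_pos_imp_increasing_open[OF \<open>a < b\<close>])
      fix t assume "a < t" "t < b"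
      with ab have "t \<in> interior ?I" by (simp add: interior_atLeastAtMost_real)
      then have "(\<phi> has_real_derivative \<bar>c\<bar> * speed \<gamma> t) (at t)"
        using \<phi>_der[OF subsetD[OF interior_subset]] at_within_interior by metis
      moreover have "0 < \<bar>c\<bar> * speed \<gamma> t"
        using c(1) speed_pos by simp
      ultimately show "\<exists>y. (\<phi> has_real_derivative y) (at t) \<and> 0 < y" by blast
    next
      show "continuous_on {a..b} \<phi>"
        using cont by (rule continuous_on_subset) (use ab in auto)
    qed
  qed
  have \<phi>_0: "\<phi> 0 = 0" by (simp add: \<phi>_def \<Phi>_0)
  have \<phi>_pos: "0 < \<phi> (2 * pi)"
    using strict_mono_onD[OF mono, of 0 "2 * pi"] by (simp add: \<phi>_0)
  \<comment> \<open>The curve closes up, so the total angle is a whole number of turns.\<close>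
  have "lift \<gamma> (2 * pi) = lift \<gamma> 0"
    using periodic_lift by (auto simp: periodic_def dest: spec[of _ 0])
  then have "cos (\<Phi> (2 * pi)) *\<^sub>R u + sin (\<Phi> (2 * pi)) *\<^sub>R quarter_turn u = 1 *\<^sub>R u + 0 *\<^sub>R quarter_turn u"
    by (simp add: param \<Phi>_0)
  then have "cos (\<phi> (2 * pi)) = 1"
    unfolding rotated_vector_eq_iff[OF u] trig by simp
  then obtain n :: int where n: "\<phi> (2 * pi) = 2 * pi * real_of_int n"
    by (auto simp: cos_one_2pi_int algebra_simps)
  with \<phi>_pos have "0 < n" by (simp add: zero_less_mult_iff)
  define m where "m = nat n"
  have m: "\<phi> (2 * pi) = 2 * pi * real m" "0 < m"
    using \<open>0 < n\<close> n by (simp_all add: m_def)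
  have fibre: "finite {z \<in> unit_circle. \<gamma> z = p} \<and> card {z \<in> unit_circle. \<gamma> z = p} = m"
    if "p \<in> sphere x (norm u)" for p
    by (rule card_circle_fibre[OF cont mono \<phi>_0 m(1) u sgn _ that])
       (use param in \<open>simp add: lift_def trig\<close>)
  have "\<bar>\<Phi> (2 * pi)\<bar> = \<phi> (2 * pi)"
    using \<phi>_pos c(1) by (auto simp: \<phi>_def sgn_if split: if_splits)
  moreover have "tangent_winding \<gamma> = \<Phi> (2 * pi) / (2 * pi)"
    by (simp add: tangent_winding_def \<Phi>_def c)
  ultimately have winding: "\<bar>tangent_winding \<gamma>\<bar> = real m"
    by (simp add: m)
  have image: "\<gamma> ` unit_circle = sphere x (norm u)"
  proof
    show "\<gamma> ` unit_circle \<subseteq> sphere x (norm u)"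
    proof safe
      fix z :: complex assume "z \<in> unit_circle"
      then obtain t where t: "t \<in> {0..<2 * pi}" "z = cis t"
        using bij_betw_imp_surj_on[OF bij_betw_cis_unit_circle] by blast
      then have "\<gamma> z - x = cos (\<phi> t) *\<^sub>R u + (sgn c * sin (\<phi> t)) *\<^sub>R quarter_turn u"
        using param[of t] by (simp add: lift_def trig)
      then show "\<gamma> z \<in> sphere x (norm u)"
        by (simp only: mem_sphere dist_norm norm_minus_commute[of x] norm_rotated_vector[OF sgn])
    qed
    show "sphere x (norm u) \<subseteq> \<gamma> ` unit_circle"
    proof
      fix p assume "p \<in> sphere x (norm u)"
      then have "card {z \<in> unit_circle. \<gamma> z = p} \<noteq> 0"
        using fibre m(2) by simp
      then have "{z \<in> unit_circle. \<gamma> z = p} \<noteq> {}"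
        by (metis card.empty)
      then show "p \<in> \<gamma> ` unit_circle" by blast
    qed
  qed
  have "0 < norm u" using u by simp
  show ?thesis
    unfolding standard_round_circle_def
  proof (intro conjI exI ballI)
    show "real (card {z \<in> unit_circle. \<gamma> z = p}) = \<bar>tangent_winding \<gamma>\<bar>"
      if "p \<in> sphere x (norm u)" for p
      using fibre[OF that] winding by simp
  qed (use assms(1) fibre image \<open>0 < norm u\<close> in blast)+
qed

end
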